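(* Let $W=W(r)$, $r=|x|$, be a radial potential on $\mathbb{R}^2$ such that $W'(r)>0$ and $-\alpha\le\frac{rW''(r)}{W'(r)}\le A$ for all $r>0$, for some constants $1<\alpha<3$ and $A>0$. Then $W$ is essentially radially contractive (ERC), i.e.: for any $R_1>0$ there exists $R>R_1$ such that $$F[\phi_\epsilon,W](r,s)\ge 0$$ for all $0<\epsilon\le R_1$ and all $r>s\ge R$.
   Context: For functions $\phi,W$ on $\mathbb{R}^2$ and $r>s>0$, $$F[\phi,W](r,s)=\int_{-\pi}^{\pi}\Big(\nabla\phi\big((r,0)^T\big)-\nabla\phi\big((s\cos\theta,s\sin\theta)^T\big)\Big)\cdot\nabla W\Big((r,0)^T-(s\cos\theta,s\sin\theta)^T\Big)\,d\theta,$$ where $W(x)$ means $W(|x|)$. For $\epsilon>0$, $\phi_\epsilon(x)=\delta(|x|-\epsilon)*\frac{1}{2\pi}\ln|x|$, where $\delta(|x|-\epsilon)$ is the arc-length measure (total mass $2\pi\epsilon$) on the circle $\{|x|=\epsilon\}$; that is, $\phi_\epsilon(x)=\frac{\epsilon}{2\pi}\int_{-\pi}^{\pi}\ln\big|x-\epsilon(\cos\theta,\sin\theta)^T\big|\,d\theta$. *)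

theory Defs
  imports "HOL-Analysis.Analysis"
begin

(* Meaningful at points of differentiability, where the gradient is unique; see grad_eqI. *)
definition grad :: "('a::euclidean_space \<Rightarrow> real) \<Rightarrow> 'a \<Rightarrow> 'a" where
  "grad f x = (THE D. GDERIV f x :> D)"

lemma grad_eqI:
  assumes "GDERIV f x :> D"
  shows "grad f x = D"
  unfolding grad_def
proof (rule the_equality)
  show "GDERIV f x :> D" by (rule assms)
next
  fix E assume "GDERIV f x :> E"
  then have "(\<lambda>h. h \<bullet> E) = (\<lambda>h. h \<bullet> D)"
    using assms unfolding gderiv_def by (rule has_derivative_unique)
  then show "E = D"
    by (metis vector_eq_ldot)
qed

definition polar :: "real \<Rightarrow> real \<Rightarrow> real ^ 2" where
  "polar s \<theta> = vector [s * cos \<theta>, s * sin \<theta>]"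

(* W is the radial profile of the potential: the potential itself is \<lambda>x. W (norm x). *)
definition F :: "(real ^ 2 \<Rightarrow> real) \<Rightarrow> (real \<Rightarrow> real) \<Rightarrow> real \<Rightarrow> real \<Rightarrow> real" where
  "F \<phi> W r s =
     (LBINT \<theta>:{-pi..pi}.
        (grad \<phi> (vector [r, 0]) - grad \<phi> (polar s \<theta>)) \<bullet>
        grad (\<lambda>x. W (norm x)) (vector [r, 0] - polar s \<theta>))"

(* Convolution of the arc-length measure on the circle of radius \<epsilon> (total mass 2 pi \<epsilon>)
   with ln |x| / (2 pi), written out by parametrising the circle by the angle. *)
definition phi_eps :: "real \<Rightarrow> real ^ 2 \<Rightarrow> real" where
  "phi_eps \<epsilon> x =
     \<epsilon> / (2 * pi) * (LBINT \<theta>:{-pi..pi}. ln (norm (x - polar \<epsilon> \<theta>)))"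

definition essentially_radially_contractive :: "(real \<Rightarrow> real) \<Rightarrow> bool" where
  "essentially_radially_contractive W \<longleftrightarrow>
     (\<forall>R1>0. \<exists>R>R1. \<forall>\<epsilon> r s.
        0 < \<epsilon> \<and> \<epsilon> \<le> R1 \<and> s < r \<and> R \<le> s \<longrightarrow> F (phi_eps \<epsilon>) W r s \<ge> 0)"

end

theory Submission
  imports Defs "HOL-Complex_Analysis.Complex_Analysis"
begin

text \<open>
  By Newton's theorem the circle of radius \<open>\<epsilon>\<close> acts from outside like a point mass at its centre:
  \<open>phi_eps \<epsilon> x = \<epsilon> ln |x|\<close> for \<open>|x| > \<epsilon>\<close> (\<open>phi_eps_outside\<close>; this is the mean value property of the
  logarithm). Hence for \<open>r > s > \<epsilon>\<close>, with \<open>d\<^sup>2 = r\<^sup>2 + s\<^sup>2 - 2 r s cos \<theta>\<close> the squared distance of the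
  two points,
  \<open>F = \<epsilon> \<integral> N W'(d) / d d\<theta>\<close> with
  \<open>N = 2 - (r/s + s/r) cos \<theta> = ((r\<^sup>2 + s\<^sup>2) d\<^sup>2 - (r\<^sup>2 - s\<^sup>2)\<^sup>2) / (2 r\<^sup>2 s\<^sup>2)\<close>.

  The weight \<open>N\<close> has the sign of \<open>d - d0\<close>, where \<open>d0 = (r\<^sup>2 - s\<^sup>2) / sqrt (r\<^sup>2 + s\<^sup>2)\<close>. The lower bound on
  \<open>d W''(d) / W'(d)\<close> makes \<open>m(d) = d\<^sup>3 W'(d)\<close> nondecreasing (\<open>mono_cube_times_deriv\<close>). Therefore
  \<open>N W'(d) / d = N m(d) / d^4 \<ge> m(d0) N / d^4\<close> for every angle, and the exponent 3 is exactly the one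
  for which the right-hand side integrates to zero, because \<open>N / d^4\<close> is the derivative of
  \<open>- sin \<theta> / (r s d\<^sup>2)\<close> (\<open>integral_cubic_kernel\<close>). The inequality thus holds for all \<open>r > s > \<epsilon>\<close>, and
  any \<open>R > R1\<close> serves in the definition.
\<close>

lemma has_integral_ln_norm_circle:
  fixes z :: complex
  assumes "0 < \<epsilon>" "\<epsilon> < cmod z"
  shows "((\<lambda>\<theta>. ln (cmod (z - of_real \<epsilon> * cis \<theta>))) has_integral 2 * pi * ln (cmod z)) {-pi..pi}"
proof -
  \<comment> \<open>The disc of radius \<open>\<epsilon>\<close> is mapped into the right half-plane by \<open>1 + w / z\<close>, so this is holomorphic there.\<close>
  define f where "f w = Ln (1 + w / z)" for w
  have z: "z \<noteq> 0" using assms by auto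
  have pos: "0 < Re (1 + w / z)" if "cmod w \<le> \<epsilon>" for w
  proof -
    have "cmod (w / z) < 1" using that assms z by (simp add: norm_divide divide_simps)
    then show ?thesis using abs_Re_le_cmod[of "w / z"] by simp
  qed
  have "f holomorphic_on cball 0 \<epsilon>"
    unfolding f_def using z pos by (force intro!: holomorphic_intros simp: complex_nonpos_Reals_iff)
  then have "((\<lambda>w. f w / (w - 0)) has_contour_integral (2 * of_real pi * \<i> * f 0)) (circlepath 0 \<epsilon>)"
    by (rule Cauchy_integral_circlepath_simple) (use assms in auto)
  then have "((\<lambda>t. f (of_real \<epsilon> * cis t) / (of_real \<epsilon> * cis t) * of_real \<epsilon> * \<i> * cis t)
              has_integral 0) {0..2*pi}"
    unfolding circlepath_def by (subst (asm) has_contour_integral_part_circlepath_iff) (auto simp: f_def)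
  then have "((\<lambda>t. \<i> * f (of_real \<epsilon> * cis t)) has_integral 0) {0..2*pi}"
    by (rule has_integral_eq[rotated]) (use assms in \<open>auto simp: field_simps\<close>)
  from has_integral_linear[OF this bounded_linear_Im]
  have "((\<lambda>t. Re (f (of_real \<epsilon> * cis t))) has_integral 0) {0..2*pi}"
    by (simp add: o_def)
  \<comment> \<open>The shift by \<open>pi\<close> moves the interval and turns \<open>1 + w / z\<close> into \<open>1 - w / z = (z - w) / z\<close>.\<close>
  from has_integral_shift_real_ivl[OF this, of pi]
  have "((\<lambda>t. Re (f (of_real \<epsilon> * cis (t + pi)))) has_integral 0) {-pi..pi}"
    by simp
  then have "((\<lambda>t. Re (f (of_real \<epsilon> * cis (t + pi))) + ln (cmod z)) has_integral
               (0 + (pi - (-pi)) *\<^sub>R ln (cmod z))) {-pi..pi}"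
    by (rule has_integral_add) (use has_integral_const_real[of "ln (cmod z)" "-pi" pi] in auto)
  then have "((\<lambda>t. Re (f (of_real \<epsilon> * cis (t + pi))) + ln (cmod z)) has_integral
               2 * pi * ln (cmod z)) {-pi..pi}"
    by simp
  then show ?thesis
  proof (rule has_integral_eq[rotated])
    fix t :: real
    have cis: "cis (t + pi) = - cis t" by (simp add: complex_eq_iff)
    have eq: "1 + of_real \<epsilon> * cis (t + pi) / z = (z - of_real \<epsilon> * cis t) / z"
      unfolding cis using z by (simp add: field_simps)
    have ne: "z - of_real \<epsilon> * cis t \<noteq> 0"
    proof
      assume "z - of_real \<epsilon> * cis t = 0"
      then have "cmod z = cmod (of_real \<epsilon> * cis t)" by simp
      then show False using assms by (simp add: norm_mult)
    qed
    have "Re (f (of_real \<epsilon> * cis (t + pi))) = ln (cmod ((z - of_real \<epsilon> * cis t) / z))"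
      unfolding f_def eq using ne z by (subst Re_Ln) auto
    also have "\<dots> = ln (cmod (z - of_real \<epsilon> * cis t)) - ln (cmod z)"
      using ne z by (simp add: norm_divide ln_div)
    finally show "Re (f (of_real \<epsilon> * cis (t + pi))) + ln (cmod z) = ln (cmod (z - of_real \<epsilon> * cis t))"
      by simp
  qed
qed

lemma norm_vec_2: "norm (x :: real ^ 2) = sqrt ((x $ 1)\<^sup>2 + (x $ 2)\<^sup>2)"
  by (simp add: norm_vec_def L2_set_def sum_2)

lemma phi_eps_outside:
  assumes "0 < \<epsilon>" "\<epsilon> < norm x"
  shows "phi_eps \<epsilon> x = \<epsilon> * ln (norm x)"
proof -
  define z where "z = Complex (x $ 1) (x $ 2)"
  have nz: "cmod z = norm x" by (simp add: z_def cmod_def norm_vec_2)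
  have nd: "cmod (z - of_real \<epsilon> * cis \<theta>) = norm (x - polar \<epsilon> \<theta>)" for \<theta>
    by (simp add: z_def cmod_def norm_vec_2 polar_def)
  have int: "((\<lambda>\<theta>. ln (norm (x - polar \<epsilon> \<theta>))) has_integral 2 * pi * ln (norm x)) {-pi..pi}"
    using has_integral_ln_norm_circle[of \<epsilon> z] assms by (simp add: nz nd)
  have ne: "norm (x - polar \<epsilon> \<theta>) \<noteq> 0" for \<theta>
  proof -
    have "norm (polar \<epsilon> \<theta>) = \<epsilon>"
      using assms by (simp add: norm_vec_2 polar_def power_mult_distrib flip: distrib_left)
    then show ?thesis using assms by auto
  qed
  have "continuous_on {-pi..pi} (\<lambda>\<theta>. norm (x - polar \<epsilon> \<theta>))"
    unfolding norm_vec_2 polar_def by (simp, intro continuous_intros)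
  then have "continuous_on {-pi..pi} (\<lambda>\<theta>. ln (norm (x - polar \<epsilon> \<theta>)))"
    by (rule continuous_on_ln) (use ne in auto)
  then have "set_integrable lborel {-pi..pi} (\<lambda>\<theta>. ln (norm (x - polar \<epsilon> \<theta>)))"
    by (rule borel_integrable_atLeastAtMost')
  then have "(LBINT \<theta>:{-pi..pi}. ln (norm (x - polar \<epsilon> \<theta>))) = 2 * pi * ln (norm x)"
    using int by (simp add: set_borel_integral_eq_integral integral_unique)
  then show ?thesis by (simp add: phi_eps_def)
qed

lemma GDERIV_radial:
  assumes "x \<noteq> 0" "(V has_real_derivative D) (at (norm x))"
  shows "GDERIV (\<lambda>x. V (norm x)) x :> (D / norm x) *\<^sub>R x"
  using GDERIV_DERIV_compose[OF GDERIV_norm assms(2)] assms(1)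
  by (simp add: sgn_div_norm divide_inverse)

lemma grad_phi_eps_outside:
  assumes "0 < \<epsilon>" "\<epsilon> < norm x"
  shows "grad (phi_eps \<epsilon>) x = (\<epsilon> / (norm x)\<^sup>2) *\<^sub>R x"
proof (rule grad_eqI)
  have x: "x \<noteq> 0" using assms by auto
  have "((\<lambda>t. \<epsilon> * ln t) has_real_derivative \<epsilon> * (1 / norm x)) (at (norm x))"
    using x by (auto intro!: derivative_eq_intros simp: divide_inverse)
  from GDERIV_radial[OF x this]
  have "((\<lambda>x. \<epsilon> * ln (norm x)) has_derivative (\<lambda>h. h \<bullet> ((\<epsilon> / (norm x)\<^sup>2) *\<^sub>R x))) (at x)"
    by (simp add: gderiv_def power2_eq_square)
  moreover have "open {y :: real ^ 2. \<epsilon> < norm y}"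
    by (intro open_Collect_less continuous_intros)
  ultimately show "GDERIV (phi_eps \<epsilon>) x :> (\<epsilon> / (norm x)\<^sup>2) *\<^sub>R x"
    unfolding gderiv_def
    by (rule has_derivative_transform_within_open) (use assms in \<open>auto simp: phi_eps_outside\<close>)
qed

lemma mono_cube_times_deriv:
  fixes W :: "real \<Rightarrow> real"
  assumes diff: "\<And>r. r > 0 \<Longrightarrow> deriv W differentiable (at r)"
    and pos: "\<And>r. r > 0 \<Longrightarrow> deriv W r > 0"
    and bound: "\<And>r. r > 0 \<Longrightarrow> - 3 \<le> r * deriv (deriv W) r / deriv W r"
    and "0 < a" "a \<le> b"
  shows "deriv W a * a ^ 3 \<le> deriv W b * b ^ 3"
proof (rule DERIV_nonneg_imp_nondecreasing[OF \<open>a \<le> b\<close>])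
  fix x assume "a \<le> x" "x \<le> b"
  then have x: "x > 0" using assms by simp
  have "(deriv W has_real_derivative deriv (deriv W) x) (at x)"
    using diff[OF x] DERIV_deriv_iff_real_differentiable by blast
  then have "((\<lambda>x. deriv W x * x ^ 3) has_real_derivative
      deriv (deriv W) x * x ^ 3 + deriv W x * (3 * x\<^sup>2)) (at x)"
    by (auto intro!: derivative_eq_intros)
  moreover have "0 \<le> x\<^sup>2 * (x * deriv (deriv W) x + 3 * deriv W x)"
    using bound[OF x] pos[OF x] x by (intro mult_nonneg_nonneg) (auto simp: field_simps)
  then have "0 \<le> deriv (deriv W) x * x ^ 3 + deriv W x * (3 * x\<^sup>2)"
    by (simp add: algebra_simps power3_eq_cube power2_eq_square)
  ultimately show "\<exists>y. ((\<lambda>x. deriv W x * x ^ 3) has_real_derivative y) (at x) \<and> 0 \<le> y"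
    by blast
qed

lemma sq_dist_pos:
  fixes r s :: real
  assumes "0 < s" "s < r"
  shows "0 < r\<^sup>2 + s\<^sup>2 - 2 * r * s * cos \<theta>"
proof -
  have "r * s * cos \<theta> \<le> r * s * 1" using assms by (intro mult_left_mono) auto
  moreover have "0 < (r - s)\<^sup>2" using assms by simp
  ultimately show ?thesis by (simp add: power2_diff)
qed

text \<open>Here \<open>(r\<^sup>2 + s\<^sup>2 - 2 r s cos \<theta>)\<^sup>2\<close> is \<open>d^4\<close>; this is the borderline case \<open>W'(d) = d powr (- 3)\<close> of
  the inequality, in which it is an equality.\<close>

lemma integral_cubic_kernel:
  fixes r s :: real
  assumes "0 < s" "s < r"
  shows "((\<lambda>\<theta>. (2 - (r / s + s / r) * cos \<theta>) / (r\<^sup>2 + s\<^sup>2 - 2 * r * s * cos \<theta>)\<^sup>2) has_integral 0) {-pi..pi}"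
proof -
  define g where "g \<theta> = - sin \<theta> / (r * s * (r\<^sup>2 + s\<^sup>2 - 2 * r * s * cos \<theta>))" for \<theta>
  define q where "q \<theta> = r\<^sup>2 + s\<^sup>2 - 2 * r * s * cos \<theta>" for \<theta>
  have "(g has_real_derivative (2 - (r / s + s / r) * cos \<theta>) / (q \<theta>)\<^sup>2) (at \<theta>)" for \<theta>
  proof -
    have q: "q \<theta> > 0" unfolding q_def by (rule sq_dist_pos[OF assms])
    have dq: "(q has_real_derivative 2 * r * s * sin \<theta>) (at \<theta>)"
      unfolding q_def by (auto intro!: derivative_eq_intros)
    have g: "g = (\<lambda>\<theta>. - sin \<theta> / (r * s * q \<theta>))" by (simp add: g_def q_def fun_eq_iff)
    have "(g has_real_derivative
        (- cos \<theta> * (r * s * q \<theta>) - - sin \<theta> * (r * s * (2 * r * s * sin \<theta>))) / (r * s * q \<theta>)\<^sup>2) (at \<theta>)"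
      unfolding g power2_eq_square using q assms
      by (intro DERIV_divide DERIV_minus DERIV_sin DERIV_cmult dq) auto
    also have "(- cos \<theta> * (r * s * q \<theta>) - - sin \<theta> * (r * s * (2 * r * s * sin \<theta>)))
        = r * s * (2 * r * s * (sin \<theta>)\<^sup>2 - cos \<theta> * q \<theta>)"
      by (simp add: algebra_simps power2_eq_square)
    also have "2 * r * s * (sin \<theta>)\<^sup>2 - cos \<theta> * q \<theta> = 2 * r * s - (r\<^sup>2 + s\<^sup>2) * cos \<theta>"
      unfolding q_def sin_squared_eq by (simp add: algebra_simps power2_eq_square)
    also have "\<dots> = r * s * (2 - (r / s + s / r) * cos \<theta>)"
      using assms by (simp add: field_simps power2_eq_square)
    also have "r * s * (r * s * (2 - (r / s + s / r) * cos \<theta>)) / (r * s * q \<theta>)\<^sup>2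
        = (2 - (r / s + s / r) * cos \<theta>) / (q \<theta>)\<^sup>2"
      using assms q by (simp add: power_mult_distrib power2_eq_square)
    finally show ?thesis .
  qed
  then have "((\<lambda>\<theta>. (2 - (r / s + s / r) * cos \<theta>) / (q \<theta>)\<^sup>2) has_integral (g pi - g (-pi))) {-pi..pi}"
    by (intro fundamental_theorem_of_calculus)
       (auto simp: has_real_derivative_iff_has_vector_derivative intro: has_vector_derivative_at_within)
  then show ?thesis by (simp add: g_def q_def)
qed

lemma weight_eq:
  fixes r s :: real
  assumes "0 < s" "s < r"
  shows "2 - (r / s + s / r) * c =
    ((r\<^sup>2 + s\<^sup>2) * (r\<^sup>2 + s\<^sup>2 - 2 * r * s * c) - (r\<^sup>2 - s\<^sup>2)\<^sup>2) / (2 * r\<^sup>2 * s\<^sup>2)"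
  using assms by (simp add: field_simps power2_eq_square)

text \<open>The comparison with the constant \<open>m(d0)\<close>: the weight and \<open>m(d) - m(d0)\<close> both change sign from
  nonpositive to nonnegative at \<open>d0\<close>, so their product is nonnegative.\<close>

lemma kernel_bound:
  fixes m :: "real \<Rightarrow> real"
  assumes mono: "\<And>a b. 0 < a \<Longrightarrow> a \<le> b \<Longrightarrow> m a \<le> m b"
    and rs: "0 < s" "s < r"
    and d: "0 < d" "d\<^sup>2 = r\<^sup>2 + s\<^sup>2 - 2 * r * s * c"
  shows "(2 - (r / s + s / r) * c) * m ((r\<^sup>2 - s\<^sup>2) / sqrt (r\<^sup>2 + s\<^sup>2)) \<le> (2 - (r / s + s / r) * c) * m d"
proof -
  define d0 where "d0 = (r\<^sup>2 - s\<^sup>2) / sqrt (r\<^sup>2 + s\<^sup>2)"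
  define N where "N = 2 - (r / s + s / r) * c"
  have sum: "0 < r\<^sup>2 + s\<^sup>2" using rs by (simp add: add_pos_pos)
  have "s\<^sup>2 < r\<^sup>2" using rs by (intro power_strict_mono) auto
  then have d0: "0 < d0" unfolding d0_def using sum by simp
  have d0sq: "(r\<^sup>2 - s\<^sup>2)\<^sup>2 = (r\<^sup>2 + s\<^sup>2) * d0\<^sup>2"
    using sum by (simp add: d0_def power_divide)
  have N: "N = (r\<^sup>2 + s\<^sup>2) * (d\<^sup>2 - d0\<^sup>2) / (2 * r\<^sup>2 * s\<^sup>2)"
    unfolding N_def weight_eq[OF rs] d(2)[symmetric] d0sq by (simp add: algebra_simps)
  show ?thesis
    unfolding d0_def[symmetric] N_def[symmetric]
  proof (cases "d0 \<le> d")
    case True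
    then have "d0\<^sup>2 \<le> d\<^sup>2" using d0 by (intro power_mono) auto
    then have "0 \<le> N" unfolding N using sum by simp
    then show "N * m d0 \<le> N * m d" using mono[OF d0 True] by (intro mult_left_mono)
  next
    case False
    then have "d\<^sup>2 \<le> d0\<^sup>2" using d by (intro power_mono) auto
    then have "N \<le> 0" unfolding N using sum
      by (intro divide_nonpos_nonneg mult_nonneg_nonpos) auto
    then show "N * m d0 \<le> N * m d" using mono[of d d0] d False by (intro mult_left_mono_neg) auto
  qed
qed

lemma F_phi_eps_nonneg:
  fixes W :: "real \<Rightarrow> real"
  assumes W: "\<And>r. r > 0 \<Longrightarrow> W differentiable (at r)"
    and dW: "\<And>r. r > 0 \<Longrightarrow> deriv W differentiable (at r)"
    and mono: "\<And>a b. 0 < a \<Longrightarrow> a \<le> b \<Longrightarrow> deriv W a * a ^ 3 \<le> deriv W b * b ^ 3"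
    and rs: "0 < \<epsilon>" "\<epsilon> < s" "s < r"
  shows "0 \<le> F (phi_eps \<epsilon>) W r s"
proof -
  define x where "x = (vector [r, 0] :: real ^ 2)"
  define q where "q \<theta> = r\<^sup>2 + s\<^sup>2 - 2 * r * s * cos \<theta>" for \<theta>
  define d where "d \<theta> = sqrt (q \<theta>)" for \<theta>
  define N where "N \<theta> = 2 - (r / s + s / r) * cos \<theta>" for \<theta>
  define M where "M = deriv W ((r\<^sup>2 - s\<^sup>2) / sqrt (r\<^sup>2 + s\<^sup>2)) * ((r\<^sup>2 - s\<^sup>2) / sqrt (r\<^sup>2 + s\<^sup>2)) ^ 3"
  have s: "0 < s" "0 < r" using rs by auto
  have q: "0 < q \<theta>" for \<theta> unfolding q_def using sq_dist_pos[OF s(1) rs(3)] .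
  have d: "0 < d \<theta>" "(d \<theta>)\<^sup>2 = q \<theta>" for \<theta> using q[of \<theta>] by (simp_all add: d_def)
  have nx: "norm x = r" using s by (simp add: x_def norm_vec_2)
  have np: "norm (polar s \<theta>) = s" for \<theta>
    using s by (simp add: norm_vec_2 polar_def power_mult_distrib flip: distrib_left)
  have nxp: "norm (x - polar s \<theta>) = d \<theta>" for \<theta>
  proof -
    have "(r - s * cos \<theta>)\<^sup>2 + (s * sin \<theta>)\<^sup>2 = q \<theta>"
      unfolding q_def power_mult_distrib sin_squared_eq by (simp add: algebra_simps power2_eq_square)
    then show ?thesis by (simp add: norm_vec_2 x_def polar_def d_def)
  qed
  have integrand: "(grad (phi_eps \<epsilon>) x - grad (phi_eps \<epsilon>) (polar s \<theta>)) \<bullet>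
        grad (\<lambda>x. W (norm x)) (x - polar s \<theta>) = \<epsilon> * N \<theta> * (deriv W (d \<theta>) / d \<theta>)" for \<theta>
  proof -
    have "(W has_real_derivative deriv W (d \<theta>)) (at (d \<theta>))"
      using W[OF d(1)] DERIV_deriv_iff_real_differentiable by blast
    moreover have "x - polar s \<theta> \<noteq> 0" using nxp[of \<theta>] d(1)[of \<theta>] by auto
    ultimately have "grad (\<lambda>x. W (norm x)) (x - polar s \<theta>) = (deriv W (d \<theta>) / d \<theta>) *\<^sub>R (x - polar s \<theta>)"
      using GDERIV_radial[of "x - polar s \<theta>" W] nxp[of \<theta>] by (intro grad_eqI) simp
    moreover have "((\<epsilon> / r\<^sup>2) *\<^sub>R x - (\<epsilon> / s\<^sup>2) *\<^sub>R polar s \<theta>) \<bullet> (x - polar s \<theta>) = \<epsilon> * N \<theta>"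
    proof -
      have xx: "x \<bullet> x = r\<^sup>2" and pp: "polar s \<theta> \<bullet> polar s \<theta> = s\<^sup>2"
        using nx np[of \<theta>] by (simp_all add: dot_square_norm)
      have xp: "x \<bullet> polar s \<theta> = r * s * cos \<theta>"
        by (simp add: inner_vec_def sum_2 x_def polar_def)
      show ?thesis
        unfolding inner_diff_left inner_diff_right inner_scaleR_left xx pp xp inner_commute[of "polar s \<theta>" x] N_def
        using s by (simp add: field_simps power2_eq_square)
    qed
    ultimately show ?thesis
      using rs by (simp add: grad_phi_eps_outside nx np)
  qed
  have cont_dW: "isCont (deriv W) t" if "0 < t" for t
    using dW[OF that] by (simp add: differentiable_imp_continuous_within)
  have "continuous_on {0<..} (deriv W)"
    using cont_dW by (simp add: continuous_at_imp_continuous_on)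
  then have "continuous_on {-pi..pi} (\<lambda>\<theta>. deriv W (d \<theta>))"
    by (rule continuous_on_compose2)
       (use d(1) in \<open>auto simp: d_def q_def intro!: continuous_intros\<close>)
  then have "continuous_on {-pi..pi} (\<lambda>\<theta>. \<epsilon> * N \<theta> * (deriv W (d \<theta>) / d \<theta>))"
    using d(1) unfolding N_def by (auto simp: d_def q_def less_imp_neq[symmetric] intro!: continuous_intros)
  then have int1: "set_integrable lborel {-pi..pi} (\<lambda>\<theta>. \<epsilon> * N \<theta> * (deriv W (d \<theta>) / d \<theta>))"
    by (rule borel_integrable_atLeastAtMost')
  have "continuous_on {-pi..pi} (\<lambda>\<theta>. \<epsilon> * M * (N \<theta> / (q \<theta>)\<^sup>2))"
    using q unfolding N_def by (auto simp: q_def less_imp_neq[symmetric] intro!: continuous_intros)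
  then have int2: "set_integrable lborel {-pi..pi} (\<lambda>\<theta>. \<epsilon> * M * (N \<theta> / (q \<theta>)\<^sup>2))"
    by (rule borel_integrable_atLeastAtMost')
  have "((\<lambda>\<theta>. \<epsilon> * M * (N \<theta> / (q \<theta>)\<^sup>2)) has_integral \<epsilon> * M * 0) {-pi..pi}"
    using integral_cubic_kernel[OF s(1) rs(3)] unfolding N_def q_def by (rule has_integral_mult_right)
  then have "0 = (LBINT \<theta>:{-pi..pi}. \<epsilon> * M * (N \<theta> / (q \<theta>)\<^sup>2))"
    using int2 by (simp add: set_borel_integral_eq_integral integral_unique)
  also have "\<dots> \<le> (LBINT \<theta>:{-pi..pi}. \<epsilon> * N \<theta> * (deriv W (d \<theta>) / d \<theta>))"
  proof (rule set_integral_mono[OF int2 int1])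
    fix \<theta>
    have "N \<theta> * M \<le> N \<theta> * (deriv W (d \<theta>) * d \<theta> ^ 3)"
      unfolding N_def M_def
      using d[of \<theta>] by (intro kernel_bound[where m = "\<lambda>t. deriv W t * t ^ 3", OF mono s(1) rs(3)])
        (auto simp: q_def)
    then have "\<epsilon> * (N \<theta> * M) / (q \<theta>)\<^sup>2 \<le> \<epsilon> * (N \<theta> * (deriv W (d \<theta>) * d \<theta> ^ 3)) / (q \<theta>)\<^sup>2"
      using rs by (simp add: divide_right_mono)
    also have "\<dots> = \<epsilon> * N \<theta> * (deriv W (d \<theta>) / d \<theta>)"
      unfolding d(2)[symmetric] using d(1)[of \<theta>] by (simp add: field_simps eval_nat_numeral)
    finally show "\<epsilon> * M * (N \<theta> / (q \<theta>)\<^sup>2) \<le> \<epsilon> * N \<theta> * (deriv W (d \<theta>) / d \<theta>)"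
      by (simp add: mult_ac)
  qed
  also have "\<dots> = F (phi_eps \<epsilon>) W r s"
    unfolding F_def x_def[symmetric] integrand ..
  finally show ?thesis .
qed

theorem theorem2p2:
  fixes W :: "real \<Rightarrow> real" and \<alpha> A :: real
  assumes "\<And>r. r > 0 \<Longrightarrow> W differentiable (at r)"
    and "\<And>r. r > 0 \<Longrightarrow> deriv W differentiable (at r)"
    and "1 < \<alpha>" and "\<alpha> < 3" and "A > 0"
    and "\<And>r. r > 0 \<Longrightarrow> deriv W r > 0"
    and "\<And>r. r > 0 \<Longrightarrow> - \<alpha> \<le> r * deriv (deriv W) r / deriv W r"
    and "\<And>r. r > 0 \<Longrightarrow> r * deriv (deriv W) r / deriv W r \<le> A"
  shows "essentially_radially_contractive W"
proof -
  have bound: "- 3 \<le> r * deriv (deriv W) r / deriv W r" if "r > 0" for r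
    using assms(4) assms(7)[OF that] by linarith
  have mono: "deriv W a * a ^ 3 \<le> deriv W b * b ^ 3" if "0 < a" "a \<le> b" for a b
    using mono_cube_times_deriv[OF assms(2) assms(6) bound that] .
  show ?thesis
    unfolding essentially_radially_contractive_def
  proof (intro allI impI)
    fix R1 :: real assume "R1 > 0"
    have "F (phi_eps \<epsilon>) W r s \<ge> 0" if "0 < \<epsilon> \<and> \<epsilon> \<le> R1 \<and> s < r \<and> R1 + 1 \<le> s" for \<epsilon> r s
      using that by (intro F_phi_eps_nonneg[OF assms(1,2) mono]) auto
    then show "\<exists>R>R1. \<forall>\<epsilon> r s. 0 < \<epsilon> \<and> \<epsilon> \<le> R1 \<and> s < r \<and> R \<le> s \<longrightarrow> F (phi_eps \<epsilon>) W r s \<ge> 0"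
      by (intro exI[of _ "R1 + 1"]) auto
  qed
qed

end
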